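(* Let $f=h+\overline{g}$ be a locally univalent harmonic mapping in the unit disk $\mathbb{D}$, for which $h''(0)=0$. If $|Sh(z)|\le 2c^2$ for all $z\in\mathbb{D}$, where $c\approx 0.6533$ is the first non-negative solution of the equation $2x\tan x=1$, then $f$ is injective.
   Context: Here $\mathbb{D}=\{z\in\mathbb{C}:|z|<1\}$, and $h$ and $g$ are holomorphic in $\mathbb{D}$. By Lewy's theorem, a complex-valued harmonic mapping $f$ is locally univalent if and only if its Jacobian $J_f=|f_z|^2-|f_{\overline{z}}|^2$ (which equals $|h'|^2-|g'|^2$ for $f=h+\overline{g}$) does not vanish. For a locally univalent holomorphic function $h$, its Schwarzian derivative is $Sh=\left(\frac{h''}{h'}\right)'-\frac12\left(\frac{h''}{h'}\right)^2$.
   Formalization: The mapping f is additionally assumed to have positive Jacobian at some point of the disk (i.e. to be sense-preserving); for sense-reversing f the claim fails, e.g. h(z)=z, g(z)=A exp(10z) with |A| large. *)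

theory Defs
  imports "HOL-Complex_Analysis.Complex_Analysis"
begin

definition locally_univalent_on :: "(complex \<Rightarrow> complex) \<Rightarrow> complex set \<Rightarrow> bool" where
  "locally_univalent_on f S \<longleftrightarrow> (\<forall>z\<in>S. \<exists>U. open U \<and> z \<in> U \<and> inj_on f (U \<inter> S))"

text \<open>The partial derivatives in \<open>z = x + \<i> y\<close>, and the Wirtinger derivatives built from them,
  have their intended meaning only at points where \<open>f\<close> is real-differentiable.\<close>

definition partial_x :: "(complex \<Rightarrow> complex) \<Rightarrow> complex \<Rightarrow> complex" where
  "partial_x f z = vector_derivative (\<lambda>t::real. f (z + of_real t)) (at 0)"

definition partial_y :: "(complex \<Rightarrow> complex) \<Rightarrow> complex \<Rightarrow> complex" where
  "partial_y f z = vector_derivative (\<lambda>t::real. f (z + \<i> * of_real t)) (at 0)"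

definition wirtinger_z :: "(complex \<Rightarrow> complex) \<Rightarrow> complex \<Rightarrow> complex" where
  "wirtinger_z f z = (partial_x f z - \<i> * partial_y f z) / 2"

definition wirtinger_zbar :: "(complex \<Rightarrow> complex) \<Rightarrow> complex \<Rightarrow> complex" where
  "wirtinger_zbar f z = (partial_x f z + \<i> * partial_y f z) / 2"

text \<open>The Jacobian determinant of \<open>f\<close> as a map of the real plane; for \<open>f = h + cnj g\<close> with \<open>h\<close>,
  \<open>g\<close> holomorphic it equals \<open>|h'|\<^sup>2 - |g'|\<^sup>2\<close>. By Lewy's theorem it has no zeros when \<open>f\<close> is
  locally univalent, so on a connected domain its sign at a single point decides whether such an
  \<open>f\<close> is sense-preserving or sense-reversing.\<close>

definition wirtinger_jacobian :: "(complex \<Rightarrow> complex) \<Rightarrow> complex \<Rightarrow> real" where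
  "wirtinger_jacobian f z = (cmod (wirtinger_z f z))\<^sup>2 - (cmod (wirtinger_zbar f z))\<^sup>2"

definition schwarzian :: "(complex \<Rightarrow> complex) \<Rightarrow> complex \<Rightarrow> complex" where
  "schwarzian h z =
     deriv (\<lambda>w. deriv (deriv h) w / deriv h w) z - (deriv (deriv h) z / deriv h z)\<^sup>2 / 2"

end

theory Submission
  imports Defs
begin

text \<open>The Schwarzian bound makes \<open>h\<close> a convex mapping, and a harmonic mapping obtained by adding
  \<open>cnj g\<close> with \<open>|g'| < |h'|\<close> to a convex mapping \<open>h\<close> is injective.

  The pre-Schwarzian \<open>p = h''/h'\<close> satisfies \<open>p' = Sh + p\<^sup>2/2\<close> and, as \<open>h'' 0 = 0\<close>, also \<open>p 0 =
  0\<close>, so \<open>|Sh| \<le> 2c\<^sup>2\<close> gives \<open>|p z| \<le> 2c tan (c|z|)\<close> by comparison with the real Riccati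
  equation (\<open>riccati_tan_bound\<close>). The constant \<open>c\<close> is the one for which the right-hand side
  equals 1 at \<open>|z| = 1\<close>. Hence \<open>|p| < 1\<close> in the disk. This bound has two consequences: \<open>h' z /
  h' 0\<close> has positive real part, so \<open>h\<close> is injective (\<open>noshiro_warschawski\<close>), and \<open>Re (1 + z p) >
  0\<close>, so \<open>h\<close> maps circles about 0 to curves that turn in one direction only
  (\<open>circle_chord_half_plane\<close>).

  The local univalence of \<open>f\<close> enters through Lewy's theorem (\<open>lewy_jacobian_nonzero\<close>): the
  Jacobian \<open>|h'|\<^sup>2 - |g'|\<^sup>2\<close> has no zeros, and being positive at one point it is positive
  everywhere.

  That \<open>|g'| < |h'|\<close> and the convexity of \<open>h\<close> imply injectivity is usually seen by integrating
  \<open>g'/h'\<close> along the preimage of a segment in the image of \<open>h\<close>. The proof below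
  (\<open>harmonic_shear_inj\<close>) instead bounds the difference quotient \<open>(g z - g w) / (h z - h w)\<close> by
  the maximum principle and Jack's lemma. Convexity is used in the form that the image of a
  circle about 0 lies on one side of each of its tangents.\<close>

section \<open>Lewy's theorem\<close>

lemma same_sign_imp_common_value:
  fixes r s :: "real \<Rightarrow> real"
  assumes T: "0 < T" and cont: "continuous_on {0..T} r" "continuous_on {0..T} s"
    and zero: "r 0 = 0" "s 0 = 0" and sgn: "0 < r T * s T"
  obtains t t' where "t \<in> {0<..T}" "t' \<in> {0<..T}" "r t = s t'"
proof -
  have *: "\<exists>t\<in>{0<..T}. \<exists>t'\<in>{0<..T}. r t = s t'"
    if rs: "continuous_on {0..T} r" "continuous_on {0..T} s" "r 0 = 0" "s 0 = 0" "0 < r T" "0 < s T"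
    for r s :: "real \<Rightarrow> real"
  proof -
    define m where "m = min (r T) (s T)"
    have m: "0 < m" "m \<le> r T" "m \<le> s T" using rs by (auto simp: m_def)
    obtain t where "0 \<le> t" "t \<le> T" "r t = m"
      using IVT'[of r 0 m T] m rs T by auto
    moreover obtain t' where "0 \<le> t'" "t' \<le> T" "s t' = m"
      using IVT'[of s 0 m T] m rs T by auto
    moreover have "t \<noteq> 0" "t' \<noteq> 0"
      using calculation m rs by auto
    ultimately show ?thesis
      by (intro bexI[of _ t] bexI[of _ t']) auto
  qed
  from sgn consider "0 < r T" "0 < s T" | "r T < 0" "s T < 0"
    by (auto simp: zero_less_mult_iff)
  then have "\<exists>t\<in>{0<..T}. \<exists>t'\<in>{0<..T}. r t = s t'"
  proof cases
    case 1
    then show ?thesis using * cont zero by blast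
  next
    case 2
    then have "\<exists>t\<in>{0<..T}. \<exists>t'\<in>{0<..T}. - r t = - s t'"
      by (intro * continuous_on_minus cont) (use zero in auto)
    then show ?thesis by simp
  qed
  then show ?thesis using that by blast
qed

text \<open>In the local coordinate \<open>\<eta>\<close> with \<open>z = e \<eta>\<close>, a holomorphic function near a critical point
  is its value plus a power \<open>\<eta>\<^sup>n\<close> with \<open>n \<ge> 2\<close>. The coefficient \<open>b = 0\<close> covers the degenerate
  case of a locally constant function, which is thereby treated along with the others.\<close>

lemma holomorphic_local_power_form:
  assumes holk: "k holomorphic_on S" and S: "open S" "a \<in> S" and crit: "deriv k a = 0"
  obtains r :: real and e :: "complex \<Rightarrow> complex" and n :: nat and b :: complex
  where "0 < r" "continuous_on (ball 0 r) e" "inj_on e (ball 0 r)"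
    "e 0 = a" "e ` ball 0 r \<subseteq> S" "2 \<le> n" "b \<in> {0, 1}"
    "\<And>\<eta>. \<eta> \<in> ball 0 r \<Longrightarrow> k (e \<eta>) = k a + b * \<eta> ^ n"
proof -
  obtain R where R: "0 < R" "ball a R \<subseteq> S"
    using S openE by blast
  show thesis
  proof (cases "\<forall>n>0. (deriv ^^ n) k a = 0")
    case True
    have const: "k z = k a" if "z \<in> ball a R" for z
      by (rule holomorphic_fun_eq_const_on_connected[of k "ball a R" a])
        (use True that R holk holomorphic_on_subset in auto)
    show thesis
      by (rule that[of R "\<lambda>\<eta>. a + \<eta>" 2 0])
        (use R in \<open>auto intro!: continuous_intros const simp: subset_iff dist_norm\<close>)
  next
    case False
    define n where "n = (LEAST n. 0 < n \<and> (deriv ^^ n) k a \<noteq> 0)"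
    have n: "0 < n" "(deriv ^^ n) k a \<noteq> 0"
      using LeastI_ex[of "\<lambda>n. 0 < n \<and> (deriv ^^ n) k a \<noteq> 0"] False by (auto simp: n_def)
    have nmin: "(deriv ^^ i) k a = 0" if "0 < i" "i < n" for i
      using not_less_Least[of i "\<lambda>n. 0 < n \<and> (deriv ^^ n) k a \<noteq> 0"] that by (auto simp: n_def)
    have n2: "2 \<le> n"
    proof (rule ccontr)
      assume "\<not> 2 \<le> n"
      then have "n = 1" using n(1) by simp
      with n(2) crit show False by simp
    qed
    obtain q \<rho> where \<rho>: "0 < \<rho>" and holq: "q holomorphic_on ball a \<rho>"
      and kq: "\<And>w. w \<in> ball a \<rho> \<Longrightarrow> k w - k a = ((w - a) * q w) ^ n"
      and qnz: "\<And>w. w \<in> ball a \<rho> \<Longrightarrow> q w \<noteq> 0"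
      by (rule holomorphic_factor_order_of_zero_strong[OF holk S n]) (blast intro: nmin, rule that)
    define X where "X w = (w - a) * q w" for w
    define U where "U = ball a (min \<rho> R)"
    have U: "open U" "a \<in> U" "U \<subseteq> S" "U \<subseteq> ball a \<rho>"
      using \<rho> R by (auto simp: U_def)
    have holX: "X holomorphic_on U"
      unfolding X_def by (intro holomorphic_intros holomorphic_on_subset[OF holq U(4)])
    have "(q has_field_derivative deriv q a) (at a)"
      using holq \<rho> by (intro holomorphic_derivI[of q "ball a \<rho>"]) auto
    then have "(X has_field_derivative q a) (at a)"
      unfolding X_def by (auto intro!: derivative_eq_intros)
    then have "deriv X a \<noteq> 0"
      using DERIV_imp_deriv[of X "q a" a] qnz[of a] \<rho> by auto
    from has_complex_derivative_locally_invertible[OF holX U(2,1) this]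
    obtain \<delta> where \<delta>: "0 < \<delta>" "ball a \<delta> \<subseteq> U" "open (X ` ball a \<delta>)" "inj_on X (ball a \<delta>)" .
    obtain e where hole: "e holomorphic_on X ` ball a \<delta>" and e: "\<And>z. z \<in> ball a \<delta> \<Longrightarrow> e (X z) = z"
      by (rule holomorphic_has_inverse[OF holomorphic_on_subset[OF holX \<delta>(2)] open_ball \<delta>(4)]) (rule that)
    have "X a = 0" by (simp add: X_def)
    then have "0 \<in> X ` ball a \<delta>" using \<delta>(1) by (force simp: image_iff)
    then obtain r where r: "0 < r" "ball 0 r \<subseteq> X ` ball a \<delta>"
      using \<delta>(3) openE by blast
    have inv: "e \<eta> \<in> ball a \<delta> \<and> X (e \<eta>) = \<eta>" if "\<eta> \<in> ball 0 r" for \<eta>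
    proof -
      obtain z where "z \<in> ball a \<delta>" "\<eta> = X z" using \<open>\<eta> \<in> ball 0 r\<close> r(2) by blast
      then show ?thesis using e by simp
    qed
    show thesis
    proof (rule that[of r e n 1])
      show "continuous_on (ball 0 r) e"
        using hole r(2) holomorphic_on_imp_continuous_on continuous_on_subset by blast
      show "inj_on e (ball 0 r)" by (rule inj_on_inverseI[of _ X]) (use inv in blast)
      show "e 0 = a" using e[of a] \<delta>(1) \<open>X a = 0\<close> by simp
      show "e ` ball 0 r \<subseteq> S" using inv \<delta>(2) U(3) by blast
      fix \<eta> :: complex assume "\<eta> \<in> ball 0 r"
      then have "e \<eta> \<in> ball a \<rho>" "X (e \<eta>) = \<eta>" using inv \<delta>(2) U(4) by blast+
      then have "k (e \<eta>) - k a = \<eta> ^ n" using kq by (simp add: X_def)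
      then show "k (e \<eta>) = k a + 1 * \<eta> ^ n" by (simp add: algebra_simps)
    qed (use n2 r in auto)
  qed
qed

text \<open>Near a critical point \<open>a\<close> of \<open>k\<close>, the level set of \<open>Im k\<close> through \<open>a\<close> contains at least
  three arcs that emanate from \<open>a\<close>: the rays \<open>arg \<eta> = j\<pi>/n\<close>, \<open>j = 0, 1, 2\<close>, in the coordinate of
  the power form. A function \<open>F\<close> with the same imaginary part maps all of them into one
  horizontal line. If it were injective, the images of two of the three arcs would end on the
  same side of \<open>F a\<close>, and by the intermediate value theorem these two images would have a common
  point.\<close>

lemma not_inj_on_if_Im_eq_Im_critical:
  fixes F k :: "complex \<Rightarrow> complex"
  assumes holk: "k holomorphic_on S" and S: "open S" "a \<in> S" and crit: "deriv k a = 0"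
    and contF: "continuous_on S F" and Im: "\<And>z. z \<in> S \<Longrightarrow> Im (F z) = Im (k z)"
  shows "\<not> inj_on F S"
proof
  assume inj: "inj_on F S"
  obtain r :: real and e :: "complex \<Rightarrow> complex" and n :: nat and b :: complex
    where r: "0 < r" and conte: "continuous_on (ball 0 r) e" and inje: "inj_on e (ball 0 r)"
    and e0: "e 0 = a" and eS: "e ` ball 0 r \<subseteq> S" and n: "2 \<le> n" and b: "b \<in> {0, 1}"
    and ke: "\<And>\<eta>. \<eta> \<in> ball 0 r \<Longrightarrow> k (e \<eta>) = k a + b * \<eta> ^ n"
    by (rule holomorphic_local_power_form[OF holk S crit]) (rule that)
  define T where "T = r / 2"
  have T: "0 < T" "T < r" using r by (auto simp: T_def)
  define ray where "ray j t = of_real t * cis (pi * real j / real n)" for j :: nat and t :: real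
  have ray_in: "ray j t \<in> ball 0 r" if "t \<in> {0..T}" for j t
    using that T by (simp add: ray_def norm_mult)
  have cis_ne: "cis (pi * real i / real n) \<noteq> cis (pi * real j / real n)" if "i < j" "j \<le> 2" for i j
  proof
    assume eq: "cis (pi * real i / real n) = cis (pi * real j / real n)"
    define x where "x = pi * (real j - real i) / real n"
    have "cis x = cis (pi * real j / real n) / cis (pi * real i / real n)"
      by (simp add: cis_divide x_def diff_divide_distrib algebra_simps)
    then have "cis x = 1" using eq by simp
    then have "cos x = 1" by (metis cis.sel(1) one_complex.sel(1))
    moreover have "real j - real i \<le> real n" "real j - real i > 0" using that n by auto
    then have "0 < x" "(real j - real i) / real n \<le> 1" using n by (auto simp: x_def)
    moreover from this have "x \<le> pi"
      using mult_left_mono[of "(real j - real i) / real n" 1 pi] by (simp add: x_def)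
    ultimately show False using cos_monotone_0_pi[of 0 x] by auto
  qed
  have ray_pow: "Im (ray j t ^ n) = 0" for j t
  proof -
    have "real n * (pi * real j / real n) = real j * pi"
      using n by simp
    then have "cis (pi * real j / real n) ^ n = cis (real j * pi)"
      using Complex.DeMoivre[of "pi * real j / real n" n] by simp
    then have "ray j t ^ n = of_real (t ^ n) * cis (real j * pi)"
      by (simp add: ray_def power_mult_distrib)
    then show ?thesis by simp
  qed
  have Im_ray: "Im (F (e (ray j t))) = Im (F a)" if "t \<in> {0..T}" for j t
  proof -
    have "Im (b * ray j t ^ n) = 0" using b ray_pow by auto
    moreover have "e (ray j t) \<in> S" using ray_in[OF that] eS by blast
    ultimately show ?thesis using ke[OF ray_in[OF that]] Im S by simp
  qed
  define f where "f j t = Re (F (e (ray j t)) - F a)" for j t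
  have contf: "continuous_on {0..T} (f j)" for j
  proof -
    have "continuous_on {0..T} (ray j)" unfolding ray_def by (intro continuous_intros)
    then have "continuous_on {0..T} (\<lambda>t. e (ray j t))"
      by (rule continuous_on_compose2[OF conte]) (use ray_in in auto)
    then have "continuous_on {0..T} (\<lambda>t. F (e (ray j t)))"
      by (rule continuous_on_compose2[OF contF]) (use ray_in eS in blast)
    then show ?thesis unfolding f_def by (intro continuous_intros)
  qed
  have f0: "f j 0 = 0" for j by (simp add: f_def ray_def e0)
  have disjoint: "f i t \<noteq> f j t'" if "t \<in> {0..T}" "t' \<in> {0..T}" "ray i t \<noteq> ray j t'" for i j t t'
  proof
    assume "f i t = f j t'"
    then have "F (e (ray i t)) = F (e (ray j t'))"
      using Im_ray that by (auto simp: f_def complex_eq_iff)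
    then have "e (ray i t) = e (ray j t')"
      using inj eS ray_in that by (meson image_subset_iff inj_onD)
    then show False using inje ray_in that by (meson inj_onD)
  qed
  have "f j T \<noteq> 0" for j
    using disjoint[of T 0 j j] T by (auto simp: f0 ray_def)
  then consider "0 < f 0 T * f 1 T" | "0 < f 0 T * f 2 T" | "0 < f 1 T * f 2 T"
    by (metis linorder_neqE_linordered_idom mult_neg_neg mult_pos_pos)
  then have "\<exists>i j. i < j \<and> j \<le> 2 \<and> 0 < f i T * f j T"
  proof cases
    case 1
    then show ?thesis by (intro exI[of _ 0] exI[of _ 1]) simp
  next
    case 2
    then show ?thesis by (intro exI[of _ 0] exI[of _ 2]) simp
  next
    case 3
    then show ?thesis by (intro exI[of _ 1] exI[of _ 2]) simp
  qed
  then obtain i j where ij: "i < j" "j \<le> 2" "0 < f i T * f j T" by blast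
  obtain t t' where t: "t \<in> {0<..T}" "t' \<in> {0<..T}" "f i t = f j t'"
    using same_sign_imp_common_value[OF T(1) contf contf f0 f0 ij(3)] .
  then have eq: "ray i t = ray j t'" using disjoint[of t t' i j] by auto
  then have "norm (ray i t) = norm (ray j t')" by simp
  then have "t = t'" using t by (simp add: ray_def norm_mult)
  with eq have "cis (pi * real i / real n) = cis (pi * real j / real n)"
    using t by (simp add: ray_def)
  then show False using cis_ne ij by blast
qed

text \<open>If \<open>|h'| = |g'|\<close> at \<open>a\<close>, the differential of \<open>f = h + cnj g\<close> has rank at most one there,
  so a rotation \<open>u f\<close> has an imaginary part with zero gradient at \<open>a\<close>. That imaginary part is
  the one of the holomorphic function \<open>u h - cnj u g\<close>, which is therefore critical at \<open>a\<close>.\<close>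

theorem lewy_jacobian_nonzero:
  assumes hol: "h holomorphic_on S" "g holomorphic_on S" and S: "open S" "a \<in> S"
    and inj: "inj_on (\<lambda>z. h z + cnj (g z)) S"
  shows "cmod (deriv h a) \<noteq> cmod (deriv g a)"
proof
  assume eq: "cmod (deriv h a) = cmod (deriv g a)"
  obtain u where u: "cmod u = 1" "u * deriv h a = cnj u * deriv g a"
  proof (cases "deriv h a = 0")
    case True
    then show thesis using that[of 1] eq by simp
  next
    case False
    \<comment> \<open>The rotation must satisfy \<open>u\<^sup>2 = g'/h'\<close>, because \<open>cnj u = 1/u\<close>.\<close>
    define u where "u = csqrt (deriv g a / deriv h a)"
    have "cmod u = 1" using eq False by (auto simp: u_def norm_divide)
    moreover from this have "u * cnj u = 1" by (simp add: complex_norm_square[symmetric])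
    moreover have "u * u * deriv h a = deriv g a"
      using False by (simp add: u_def power2_eq_square[symmetric])
    moreover have "cnj u * (u * u * deriv h a) = (u * cnj u) * (u * deriv h a)"
      by (simp only: mult_ac)
    ultimately show thesis using that[of u] by simp
  qed
  define k where "k z = u * h z - cnj u * g z" for z
  define F where "F z = u * (h z + cnj (g z))" for z
  have "\<not> inj_on F S"
  proof (rule not_inj_on_if_Im_eq_Im_critical[of k S a])
    show "k holomorphic_on S" unfolding k_def by (intro holomorphic_intros hol)
    have "(k has_field_derivative u * deriv h a - cnj u * deriv g a) (at a)"
      unfolding k_def by (intro derivative_intros DERIV_cmult holomorphic_derivI[OF hol(1) S] holomorphic_derivI[OF hol(2) S])
    then show "deriv k a = 0" using u(2) DERIV_imp_deriv by fastforce
    show "continuous_on S F" unfolding F_def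
      by (intro continuous_intros holomorphic_on_imp_continuous_on hol)
    show "Im (F z) = Im (k z)" for z by (simp add: F_def k_def algebra_simps)
  qed (use S in auto)
  moreover have "u \<noteq> 0" using u(1) by auto
  then have "inj_on F S" using inj by (auto simp: F_def inj_on_def)
  ultimately show False by simp
qed

section \<open>Shearing a convex mapping\<close>

lemma Re_complex_of_real_mult: "Re (of_real r * x) = r * Re x"
  by simp

text \<open>The theorem of Noshiro and Warschawski: along the segment from \<open>w\<close> to \<open>z\<close>, the component
  of \<open>c h\<close> in the direction \<open>z - w\<close> is strictly increasing.\<close>

lemma noshiro_warschawski:
  assumes holh: "h holomorphic_on S" and S: "open S" "convex S"
    and pos: "\<And>z. z \<in> S \<Longrightarrow> 0 < Re (c * deriv h z)"
  shows "inj_on h S"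
proof (rule inj_onI, rule ccontr)
  fix z w assume zw: "z \<in> S" "w \<in> S" "h z = h w" "z \<noteq> w"
  define m where "m = cnj (z - w) * c"
  have seg: "closed_segment w z \<subseteq> S" using zw S closed_segment_subset by blast
  have "((\<lambda>u. m * h u) has_field_derivative m * deriv h u) (at u)" if "u \<in> closed_segment w z" for u
    using that seg by (intro DERIV_cmult holomorphic_derivI[OF holh S(1)]) auto
  from complex_mvt_line[OF this] obtain u where u: "u \<in> closed_segment w z"
    "Re (m * h z) - Re (m * h w) = Re (m * deriv h u * (z - w))" by blast
  have "m * deriv h u * (z - w) = of_real ((cmod (z - w))\<^sup>2) * (c * deriv h u)"
    unfolding m_def complex_norm_square by (simp only: mult_ac)
  then have "Re (m * deriv h u * (z - w)) = (cmod (z - w))\<^sup>2 * Re (c * deriv h u)"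
    by (simp only: Re_complex_of_real_mult)
  moreover have "0 < (cmod (z - w))\<^sup>2 * Re (c * deriv h u)"
    using zw(4) pos u(1) seg by (intro mult_pos_pos) auto
  ultimately show False using u(2) unfolding zw(3) by linarith
qed

text \<open>The hypothesis \<open>Re (1 + z h''/h') > 0\<close> says that the tangent direction of the image of the
  circle \<open>|\<zeta>| = |z|\<close> turns strictly counterclockwise. The conclusion says that this image curve,
  except \<open>h z\<close> itself, lies strictly on one side of its tangent at \<open>h z\<close>. Let \<open>\<zeta>\<close> run once round
  the circle from \<open>z\<close> to \<open>z\<close>. The scaled distance \<open>\<phi>\<close> from the tangent has a positive multiple
  of \<open>sin \<psi>\<close> as its derivative, where the turning angle \<open>\<psi>\<close> increases from 0 to \<open>2\<pi>\<close>. Thus \<open>\<phi>\<close>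
  starts at 0, first increases, then decreases and ends at 0, so it is positive in between.\<close>

lemma circle_chord_half_plane:
  assumes holh: "h holomorphic_on ball 0 R" and holL: "L holomorphic_on ball 0 R"
    and hL: "\<And>z. z \<in> ball 0 R \<Longrightarrow> deriv h z = exp (L z)"
    and convex: "\<And>z. z \<in> ball 0 R \<Longrightarrow> 0 < Re (1 + z * deriv L z)"
    and z: "z \<in> ball 0 R" and zw: "cmod w = cmod z" "w \<noteq> z"
  shows "0 < Re ((h z - h w) / (z * deriv h z))"
proof -
  have "z \<noteq> 0" using zw by auto
  define \<theta> where "\<theta> = Arg2pi (w / z)"
  have "cmod (w / z) = 1" using zw \<open>z \<noteq> 0\<close> by (simp add: norm_divide)
  then have "w / z = cis \<theta>"
    using Arg2pi_eq[of "w / z"] by (simp add: \<theta>_def cis_conv_exp)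
  then have w: "w = z * cis \<theta>" using \<open>z \<noteq> 0\<close> by (simp add: field_simps)
  have "0 \<le> \<theta>" "\<theta> < 2 * pi" by (auto simp: \<theta>_def Arg2pi_ge_0 Arg2pi_lt_2pi)
  moreover have "\<theta> \<noteq> 0" using w zw by auto
  ultimately have \<theta>: "0 < \<theta>" "\<theta> < 2 * pi" by auto
  define \<zeta> where "\<zeta> t = z * cis t" for t
  have \<zeta>_in: "\<zeta> t \<in> ball 0 R" for t using z by (simp add: \<zeta>_def norm_mult)
  have d\<zeta>: "((\<lambda>t. F (\<zeta> t)) has_vector_derivative \<i> * \<zeta> t * deriv F (\<zeta> t)) (at t)"
    if "F holomorphic_on ball 0 R" for F t
  proof -
    have "(\<zeta> has_vector_derivative \<i> * \<zeta> t) (at t)"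
      unfolding \<zeta>_def cis_conv_exp
      by (auto intro!: derivative_eq_intros has_vector_derivative_real_field simp: mult_ac)
    from field_vector_diff_chain_at[OF this holomorphic_derivI[OF that open_ball \<zeta>_in]]
    show ?thesis by (simp add: o_def)
  qed
  define D where "D t = L (\<zeta> t) - L z" for t
  define \<phi> where "\<phi> t = Re ((h z - h (\<zeta> t)) / (z * deriv h z))" for t
  define \<psi> where "\<psi> t = t + Im (D t)" for t
  have "((\<lambda>t. h z - h (\<zeta> t)) has_vector_derivative - (\<i> * \<zeta> t * deriv h (\<zeta> t))) (at t)" for t
    using has_vector_derivative_diff[OF has_vector_derivative_const d\<zeta>[OF holh]] by simp
  from bounded_linear.has_vector_derivative[OF bounded_linear_divide this]
  have "((\<lambda>t. (h z - h (\<zeta> t)) / (z * deriv h z)) has_vector_derivative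
      - (\<i> * \<zeta> t * deriv h (\<zeta> t)) / (z * deriv h z)) (at t)" for t .
  from bounded_linear.has_vector_derivative[OF bounded_linear_Re this]
  have d\<phi>': "(\<phi> has_real_derivative Re (- (\<i> * \<zeta> t * deriv h (\<zeta> t)) / (z * deriv h z))) (at t)" for t
    unfolding \<phi>_def has_real_derivative_iff_has_vector_derivative .
  have "- (\<i> * \<zeta> t * deriv h (\<zeta> t)) / (z * deriv h z) = - \<i> * (cis t * exp (D t))" for t
    using \<open>z \<noteq> 0\<close> hL[OF \<zeta>_in] hL[OF z] by (simp add: D_def exp_diff \<zeta>_def)
  moreover have "Re (- \<i> * (cis t * exp (D t))) = exp (Re (D t)) * sin (\<psi> t)" for t
    by (simp add: \<psi>_def sin_add Re_exp Im_exp algebra_simps)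
  ultimately have d\<phi>: "(\<phi> has_real_derivative exp (Re (D t)) * sin (\<psi> t)) (at t)" for t
    using d\<phi>' by simp
  have "(D has_vector_derivative \<i> * \<zeta> t * deriv L (\<zeta> t)) (at t)" for t
    unfolding D_def using has_vector_derivative_diff[OF d\<zeta>[OF holL] has_vector_derivative_const] by simp
  from bounded_linear.has_vector_derivative[OF bounded_linear_Im this]
  have "((\<lambda>t. Im (D t)) has_real_derivative Im (\<i> * \<zeta> t * deriv L (\<zeta> t))) (at t)" for t
    unfolding has_real_derivative_iff_has_vector_derivative .
  from DERIV_add[OF DERIV_ident this]
  have d\<psi>: "(\<psi> has_real_derivative 1 + Im (\<i> * \<zeta> t * deriv L (\<zeta> t))) (at t)" for t
    unfolding \<psi>_def .
  have "0 < 1 + Im (\<i> * \<zeta> t * deriv L (\<zeta> t))" for t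
    using convex[OF \<zeta>_in[of t]] by (simp add: mult.assoc)
  then have mono: "\<psi> s < \<psi> t" if "s < t" for s t
    using DERIV_pos_imp_increasing[OF that, of \<psi>] d\<psi> by blast
  have ends: "\<psi> 0 = 0" "\<psi> (2 * pi) = 2 * pi" "\<phi> 0 = 0" "\<phi> (2 * pi) = 0"
    by (simp_all add: \<psi>_def \<phi>_def D_def \<zeta>_def cis_2pi)
  have cont: "continuous_on A \<phi>" for A
    using d\<phi> DERIV_isCont continuous_at_imp_continuous_on by blast
  have "0 < \<phi> \<theta>"
  proof (cases "\<psi> \<theta> \<le> pi")
    case True
    have "\<phi> 0 < \<phi> \<theta>"
    proof (rule DERIV_pos_imp_increasing_open[OF \<theta>(1) _ cont])
      fix t assume t: "0 < t" "t < \<theta>"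
      then have "0 < \<psi> t" "\<psi> t < pi" using mono[OF t(1)] mono[OF t(2)] True ends by auto
      then show "\<exists>y. (\<phi> has_real_derivative y) (at t) \<and> 0 < y"
        using d\<phi>[of t] sin_gt_zero by force
    qed
    then show ?thesis using ends by simp
  next
    case False
    have "\<phi> (2 * pi) < \<phi> \<theta>"
    proof (rule DERIV_neg_imp_decreasing_open[OF \<theta>(2) _ cont])
      fix t assume t: "\<theta> < t" "t < 2 * pi"
      then have "pi < \<psi> t" "\<psi> t < 2 * pi" using mono[OF t(1)] mono[OF t(2)] False ends by auto
      then have "sin (\<psi> t) < 0" using sin_lt_zero by blast
      then show "\<exists>y. (\<phi> has_real_derivative y) (at t) \<and> y < 0"
        using d\<phi>[of t] by (meson exp_gt_zero mult_pos_neg)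
    qed
    then show ?thesis using ends by simp
  qed
  then show ?thesis by (simp add: \<phi>_def \<zeta>_def w)
qed

text \<open>Jack's lemma: at a point where \<open>|Q|\<close> is maximal on a disk around 0, the logarithmic
  derivative \<open>z Q'/Q\<close> is real, since \<open>|Q|\<close> is stationary along the circle, and nonnegative,
  since \<open>|Q|\<close> does not decrease along the radius outwards. Both are obtained at once by testing
  the directions \<open>z d\<close> with \<open>Re d < 0\<close>, which point into the disk.\<close>

lemma jack_maximum_modulus:
  assumes holQ: "Q holomorphic_on S" "open S" "z \<in> S" and Qz: "Q z \<noteq> 0"
    and max: "\<And>w. w \<in> ball 0 (cmod z) \<Longrightarrow> cmod (Q w) \<le> cmod (Q z)"
  obtains k :: real where "0 \<le> k" "z * deriv Q z = of_real k * Q z"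
proof -
  define D where "D = z * deriv Q z / Q z"
  have dir: "Re (d * D) \<le> 0" if d: "Re d < 0" for d
  proof (cases "z = 0")
    case True
    then show ?thesis by (simp add: D_def)
  next
    case False
    show ?thesis
    proof (rule ccontr)
      assume "\<not> Re (d * D) \<le> 0"
      define p where "p t = z * (1 + of_real t * d)" for t
      have "(p has_vector_derivative z * d) (at 0)"
        unfolding p_def by (auto intro!: derivative_eq_intros has_vector_derivative_real_field)
      then have "(Q \<circ> p has_vector_derivative z * d * deriv Q z) (at 0)"
        by (rule field_vector_diff_chain_at)
          (use holomorphic_derivI[OF holQ] in \<open>simp add: p_def\<close>)
      from bounded_linear.has_vector_derivative[OF bounded_linear_divide[of "Q z"] this]
      have "((\<lambda>t. Q (p t) / Q z) has_vector_derivative d * D) (at 0)"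
        by (simp add: D_def mult_ac)
      from bounded_linear.has_vector_derivative[OF bounded_linear_Re this]
      have "((\<lambda>t. Re (Q (p t) / Q z)) has_real_derivative Re (d * D)) (at 0)"
        unfolding has_real_derivative_iff_has_vector_derivative .
      from DERIV_pos_inc_right[OF this] \<open>\<not> Re (d * D) \<le> 0\<close>
      obtain \<delta> where \<delta>: "0 < \<delta>" "\<And>t. 0 < t \<Longrightarrow> t < \<delta> \<Longrightarrow> 1 < Re (Q (p t) / Q z)"
        using Qz by (auto simp: p_def)
      \<comment> \<open>\<open>|1 + t d|\<^sup>2 = 1 + 2 t Re d + t\<^sup>2 |d|\<^sup>2\<close> is below 1 once \<open>t |d|\<^sup>2 \<le> - Re d\<close>.\<close>
      define t where "t = min (\<delta> / 2) (- Re d / (cmod d)\<^sup>2)"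
      have "d \<noteq> 0" using d by auto
      then have t: "0 < t" "t < \<delta>" "t * (cmod d)\<^sup>2 \<le> - Re d"
        using \<delta>(1) d by (auto simp: t_def field_simps min_def)
      have "(cmod (1 + of_real t * d))\<^sup>2 = 1 + t * (2 * Re d + t * (cmod d)\<^sup>2)"
        unfolding cmod_power2 by (simp add: algebra_simps power2_eq_square)
      also have "\<dots> < 1" using t d by (simp add: mult_less_0_iff)
      finally have "cmod (1 + of_real t * d) < 1"
        by (simp add: power_less_one_iff abs_square_less_1)
      then have "cmod z * cmod (1 + of_real t * d) < cmod z * 1"
        using False by (intro mult_strict_left_mono) auto
      then have "p t \<in> ball 0 (cmod z)" by (simp add: p_def norm_mult)
      then have "cmod (Q (p t) / Q z) \<le> 1" using max Qz by (simp add: norm_divide)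
      then show False using \<delta>(2)[OF t(1,2)] complex_Re_le_cmod[of "Q (p t) / Q z"] by linarith
    qed
  qed
  have "Im D = 0"
  proof (rule ccontr)
    assume "Im D \<noteq> 0"
    \<comment> \<open>For this \<open>d\<close> the real part of \<open>d D\<close> is \<open>|Re D| + 1 - Re D > 0\<close>.\<close>
    then show False
      using dir[of "Complex (-1) (- (\<bar>Re D\<bar> + 1) / Im D)"] by simp
  qed
  moreover have "0 \<le> Re D" using dir[of "-1"] by simp
  ultimately have "0 \<le> Re D" "D = of_real (Re D)" by (auto simp: complex_eq_iff)
  moreover have "z * deriv Q z = D * Q z" using Qz by (simp add: D_def)
  ultimately show thesis using that[of "Re D"] by simp
qed

text \<open>It suffices that the difference quotient \<open>Q z = (g z - g w) / (h z - h w)\<close> has modulus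
  below 1, as \<open>f z = f w\<close> would force \<open>|Q z| = 1\<close>. For fixed \<open>w\<close> let \<open>x\<close> be a point of \<open>|x| =
  |w|\<close> where \<open>|Q|\<close> is maximal on the disk of radius \<open>|w|\<close>. Jack's lemma gives \<open>x Q' = k Q\<close> with
  \<open>k \<ge> 0\<close>, so differentiating \<open>g - g w = Q (h - h w)\<close> at \<open>x\<close> yields \<open>g'/h' = Q (1 + k A)\<close> with
  \<open>A = (h x - h w) / (x h' x)\<close>. By convexity, which enters through the hypothesis on chords, \<open>Re
  A > 0\<close>. Hence \<open>|Q x| \<le> |g'/h'| < 1\<close>.\<close>

theorem harmonic_shear_inj:
  assumes holh: "h holomorphic_on ball 0 R" and holg: "g holomorphic_on ball 0 R"
    and injh: "inj_on h (ball 0 R)"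
    and chord: "\<And>z w. z \<in> ball 0 R \<Longrightarrow> cmod w = cmod z \<Longrightarrow> w \<noteq> z \<Longrightarrow>
      0 < Re ((h z - h w) / (z * deriv h z))"
    and dil: "\<And>z. z \<in> ball 0 R \<Longrightarrow> cmod (deriv g z) < cmod (deriv h z)"
  shows "inj_on (\<lambda>z. h z + cnj (g z)) (ball 0 R)"
proof -
  let ?B = "ball (0::complex) R"
  have contraction: "cmod (g z - g w) < cmod (h z - h w)"
    if zw: "z \<in> ?B" "w \<in> ?B" "z \<noteq> w" "cmod z \<le> cmod w" for z w
  proof -
    \<comment> \<open>The values at \<open>\<zeta> = w\<close> remove the singularity of the difference quotients.\<close>
    define G where "G \<zeta> = (if \<zeta> = w then deriv g w else (g \<zeta> - g w) / (\<zeta> - w))" for \<zeta>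
    define H where "H \<zeta> = (if \<zeta> = w then deriv h w else (h \<zeta> - h w) / (\<zeta> - w))" for \<zeta>
    define Q where "Q \<zeta> = G \<zeta> / H \<zeta>" for \<zeta>
    have Hnz: "H \<zeta> \<noteq> 0" if "\<zeta> \<in> ?B" for \<zeta>
      using inj_onD[OF injh, of \<zeta> w] that zw(2) dil[of w] by (auto simp: H_def)
    have holQ: "Q holomorphic_on ?B"
      unfolding Q_def using Hnz pole_lemma_open[OF holg, of w] pole_lemma_open[OF holh, of w]
      by (intro holomorphic_intros) (auto simp: G_def H_def)
    have gQ: "g \<zeta> - g w = Q \<zeta> * (h \<zeta> - h w)" if "\<zeta> \<in> ?B" for \<zeta>
      using Hnz[OF that] by (auto simp: Q_def G_def H_def)
    have cball: "cball 0 (cmod w) \<subseteq> ?B" using zw(2) by auto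
    have contQ: "continuous_on (cball 0 (cmod w)) Q"
      using holQ cball holomorphic_on_imp_continuous_on continuous_on_subset by blast
    have "\<exists>x\<in>sphere 0 (cmod w). \<forall>y\<in>sphere 0 (cmod w). cmod (Q y) \<le> cmod (Q x)"
      by (rule continuous_attains_sup)
        (auto intro!: continuous_on_norm continuous_on_subset[OF contQ])
    then obtain x where x: "cmod x = cmod w" "\<And>y. cmod y = cmod w \<Longrightarrow> cmod (Q y) \<le> cmod (Q x)"
      by (auto simp: dist_norm)
    have xB: "x \<in> ?B" using x zw(2) by simp
    have "w \<noteq> 0" using zw by auto
    have max: "cmod (Q y) \<le> cmod (Q x)" if "y \<in> cball 0 (cmod w)" for y
      by (rule maximum_modulus_frontier[where S = "cball 0 (cmod w)"])
        (use that x contQ \<open>w \<noteq> 0\<close> holomorphic_on_subset[OF holQ] cball in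
          \<open>auto simp: subset_iff\<close>)
    have "cmod (Q x) < 1"
    proof (cases "x = w \<or> Q x = 0")
      case True
      then show ?thesis using dil[OF zw(2)] by (auto simp: Q_def G_def H_def norm_divide divide_less_eq)
    next
      case False
      obtain k where k: "0 \<le> k" "x * deriv Q x = of_real k * Q x"
        by (rule jack_maximum_modulus[OF holQ open_ball xB]) (use False max x cball that in auto)
      have "((\<lambda>\<zeta>. Q \<zeta> * (h \<zeta> - h w)) has_field_derivative
          deriv Q x * (h x - h w) + deriv h x * Q x) (at x)"
        using DERIV_mult[OF holomorphic_derivI[OF holQ open_ball xB]
            DERIV_diff[OF holomorphic_derivI[OF holh open_ball xB] DERIV_const]] by simp
      then have "((\<lambda>\<zeta>. g \<zeta> - g w) has_field_derivative
          deriv Q x * (h x - h w) + deriv h x * Q x) (at x)"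
        by (rule has_field_derivative_transform_within_open[OF _ open_ball xB]) (simp add: gQ)
      moreover have "((\<lambda>\<zeta>. g \<zeta> - g w) has_field_derivative deriv g x) (at x)"
        using DERIV_diff[OF holomorphic_derivI[OF holg open_ball xB] DERIV_const] by simp
      ultimately have g': "deriv g x = deriv Q x * (h x - h w) + deriv h x * Q x"
        using DERIV_unique by blast
      define A where "A = (h x - h w) / (x * deriv h x)"
      have "0 < Re A" unfolding A_def by (rule chord[OF xB]) (use x(1) False in auto)
      have nz: "x \<noteq> 0" "deriv h x \<noteq> 0" using x(1) \<open>w \<noteq> 0\<close> dil[OF xB] by auto
      have "deriv g x = Q x * (1 + of_real k * A) * deriv h x"
      proof -
        have "h x - h w = x * (A * deriv h x)" using nz by (simp add: A_def)
        then have "deriv Q x * (h x - h w) = (x * deriv Q x) * (A * deriv h x)"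
          by (simp only: mult_ac)
        then show ?thesis unfolding g' k(2) by (simp add: algebra_simps)
      qed
      then have "cmod (Q x) * cmod (1 + of_real k * A) < 1"
        using dil[OF xB] nz by (simp add: norm_mult)
      moreover have "1 \<le> cmod (1 + of_real k * A)"
      proof -
        have "1 \<le> Re (1 + of_real k * A)" using k(1) \<open>0 < Re A\<close> by simp
        then show ?thesis using complex_Re_le_cmod order_trans by blast
      qed
      ultimately show ?thesis
        by (metis mult.right_neutral mult_left_mono norm_ge_zero order_le_less_trans)
    qed
    then have "cmod (Q z) < 1" using max[of z] zw(4) by simp
    moreover have "h z \<noteq> h w" using injh zw by (auto dest: inj_onD)
    ultimately show ?thesis unfolding gQ[OF zw(1)] by (simp add: norm_mult)
  qed
  show ?thesis
  proof (rule inj_onI, rule ccontr)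
    fix z w assume zw: "z \<in> ?B" "w \<in> ?B" "h z + cnj (g z) = h w + cnj (g w)" "z \<noteq> w"
    then have "h z - h w = - cnj (g z - g w)" by (simp add: algebra_simps)
    then have "cmod (h z - h w) = cmod (g z - g w)" by (metis complex_mod_cnj norm_minus_cancel)
    then show False
      using contraction[of z w] contraction[of w z] zw
      by (cases "cmod z \<le> cmod w") (auto simp: norm_minus_commute)
  qed
qed

section \<open>Univalence from the Schwarzian bound\<close>

text \<open>The comparison function \<open>y t = 2c tan (c t)\<close> solves \<open>y' = 2c\<^sup>2 + y\<^sup>2/2\<close>, \<open>y 0 = 0\<close>;
  equivalently \<open>arctan (y/2c)\<close> has derivative \<open>c\<close>. Along a radius, the inequality for \<open>|p|\<close>
  makes the derivative of \<open>arctan (|p|/2c)\<close> at most \<open>c\<close>. The modulus need not be differentiable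
  where \<open>p = 0\<close>, so the estimate starts at the last zero \<open>s\<close> of \<open>p\<close> on the radius.\<close>

lemma riccati_tan_bound:
  assumes holp: "p holomorphic_on ball 0 1" and p0: "p 0 = 0" and c: "0 < c" "c \<le> pi / 2"
    and bound: "\<And>z. z \<in> ball 0 1 \<Longrightarrow> cmod (deriv p z) \<le> 2 * c\<^sup>2 + (cmod (p z))\<^sup>2 / 2"
    and z: "z \<in> ball 0 1"
  shows "cmod (p z) \<le> 2 * c * tan (c * cmod z)"
proof -
  define \<rho> where "\<rho> = cmod z"
  define e where "e = sgn z"
  have ze: "z = of_real \<rho> * e"
    by (cases "z = 0") (simp_all add: \<rho>_def e_def sgn_div_norm scaleR_conv_of_real field_simps)
  have e1: "cmod e \<le> 1" by (simp add: e_def norm_sgn)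
  have \<rho>: "0 \<le> \<rho>" "\<rho> < 1" using z by (auto simp: \<rho>_def)
  define P where "P t = p (of_real t * e)" for t :: real
  have in_ball: "of_real t * e \<in> ball 0 1" if "t \<in> {0..\<rho>}" for t
  proof -
    have "\<bar>t\<bar> * cmod e \<le> \<rho> * 1" using that e1 by (intro mult_mono) auto
    then show ?thesis using \<rho>(2) by (simp add: norm_mult)
  qed
  have contP: "continuous_on {0..\<rho>} P"
    unfolding P_def
    by (rule continuous_on_compose2[OF holomorphic_on_imp_continuous_on[OF holp]])
      (use in_ball in \<open>auto intro!: continuous_intros\<close>)
  have "arctan (cmod (P \<rho>) / (2 * c)) \<le> c * \<rho>"
  proof -
    define Z where "Z = {t \<in> {0..\<rho>}. P t = 0}"
    have "closed Z"
      unfolding Z_def by (rule continuous_closed_preimage_constant[OF contP closed_atLeastAtMost])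
    moreover have "bounded Z"
      by (rule bounded_subset[of "{0..\<rho>}"]) (auto simp: Z_def)
    ultimately have "compact Z" by (simp add: compact_eq_bounded_closed)
    moreover have "0 \<in> Z" using \<rho> p0 by (simp add: Z_def P_def)
    ultimately obtain s where s: "s \<in> Z" "\<And>t. t \<in> Z \<Longrightarrow> t \<le> s"
      using compact_attains_sup[of Z] by auto
    have s': "0 \<le> s" "s \<le> \<rho>" "P s = 0" using s(1) by (auto simp: Z_def)
    have nz: "P t \<noteq> 0" if "s < t" "t \<le> \<rho>" for t
      using s(2)[of t] that s' by (force simp: Z_def)
    define \<nu> where "\<nu> t = c * t - arctan (cmod (P t) / (2 * c))" for t
    have "\<nu> s \<le> \<nu> \<rho>"
    proof (rule DERIV_nonneg_imp_increasing_open[OF s'(2)])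
      show "continuous_on {s..\<rho>} \<nu>"
        unfolding \<nu>_def using c s' by (intro continuous_intros continuous_on_subset[OF contP]) auto
      fix t assume t: "s < t" "t < \<rho>"
      then have tB: "of_real t * e \<in> ball 0 1" using in_ball s' by auto
      define d where "d = e * deriv p (of_real t * e)"
      define N where "N = cmod (P t)"
      have "((\<lambda>t. of_real t * e) has_vector_derivative e) (at t)"
        by (auto intro!: derivative_eq_intros has_vector_derivative_real_field)
      from field_vector_diff_chain_at[OF this holomorphic_derivI[OF holp open_ball tB]]
      have "(P has_vector_derivative d) (at t)"
        by (simp add: o_def P_def[abs_def] d_def)
      then have "(P has_derivative (\<lambda>x. x *\<^sub>R d)) (at t)"
        by (simp add: has_vector_derivative_def)
      from has_derivative_compose[OF this has_derivative_norm[OF nz]] t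
      have "((\<lambda>t. cmod (P t)) has_derivative (\<lambda>x. inner (x *\<^sub>R d) (sgn (P t)))) (at t)" by simp
      then have dN: "((\<lambda>t. cmod (P t)) has_real_derivative inner d (sgn (P t))) (at t)"
        unfolding has_field_derivative_def by (rule has_derivative_eq_rhs) (simp add: fun_eq_iff)
      have "((\<lambda>t. cmod (P t) / (2 * c)) has_real_derivative inner d (sgn (P t)) / (2 * c)) (at t)"
        by (rule DERIV_cdivide[OF dN])
      from DERIV_diff[OF DERIV_cmult_Id DERIV_chain2[OF DERIV_arctan this], of c]
      have d\<nu>: "(\<nu> has_real_derivative
          c - inverse (1 + (N / (2 * c))\<^sup>2) * (inner d (sgn (P t)) / (2 * c))) (at t)"
        unfolding \<nu>_def[abs_def] N_def by simp
      have "inner d (sgn (P t)) \<le> cmod d * cmod (sgn (P t))" by (rule norm_cauchy_schwarz)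
      also have "\<dots> = cmod d" using nz[of t] t by (simp add: norm_sgn)
      also have "\<dots> \<le> cmod (deriv p (of_real t * e))"
        unfolding d_def norm_mult using e1 by (intro mult_left_le_one_le) auto
      also have "\<dots> \<le> 2 * c\<^sup>2 + N\<^sup>2 / 2" using bound[OF tB] by (simp add: N_def P_def)
      also have "\<dots> = 2 * c\<^sup>2 * (1 + (N / (2 * c))\<^sup>2)"
        using c by (simp add: power2_eq_square field_simps)
      finally have *: "inner d (sgn (P t)) \<le> 2 * c\<^sup>2 * (1 + (N / (2 * c))\<^sup>2)" .
      have "inverse X * (y / (2 * c)) \<le> c" if "y \<le> 2 * c\<^sup>2 * X" "0 < X" for X y :: real
        using that c by (simp add: field_simps power2_eq_square)
      from this[OF *] have "inverse (1 + (N / (2 * c))\<^sup>2) * (inner d (sgn (P t)) / (2 * c)) \<le> c"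
        by (simp add: add_pos_nonneg)
      then show "\<exists>y. (\<nu> has_real_derivative y) (at t) \<and> 0 \<le> y"
        using d\<nu> by (intro exI conjI) auto
    qed
    moreover have "0 \<le> c * s" using c s' by simp
    ultimately show ?thesis using s'(3) by (simp add: \<nu>_def)
  qed
  moreover have "c * \<rho> < pi / 2"
  proof -
    have "c * \<rho> < c * 1" using c \<rho> by (intro mult_strict_left_mono) auto
    then show ?thesis using c(2) by linarith
  qed
  ultimately have "tan (arctan (cmod (P \<rho>) / (2 * c))) \<le> tan (c * \<rho>)"
    using arctan_lbound by (intro tan_mono_le) auto
  then have "cmod (P \<rho>) \<le> 2 * c * tan (c * \<rho>)"
    using c by (simp add: tan_arctan divide_le_eq mult.commute)
  moreover have "P \<rho> = p z" unfolding P_def ze[symmetric] ..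
  ultimately show ?thesis by (simp add: \<rho>_def)
qed

text \<open>This keeps the comparison function \<open>2c tan (c t)\<close> finite for \<open>t \<le> 1\<close>: at \<open>\<pi>/4\<close> the
  function \<open>2x tan x\<close> has the value \<open>\<pi>/2\<close>, which exceeds 1.\<close>

lemma first_root_le_pi_quarter:
  assumes "\<And>x. 0 \<le> x \<Longrightarrow> x < c \<Longrightarrow> 2 * x * tan x \<noteq> (1::real)"
  shows "c \<le> pi / 4"
proof -
  have "cos x \<noteq> 0" if "0 \<le> x" "x \<le> pi / 4" for x :: real
    using cos_gt_zero_pi[of x] that pi_gt_zero by fastforce
  then have "continuous_on {0..pi / 4} (\<lambda>x::real. 2 * x * tan x)"
    by (intro continuous_intros) auto
  moreover have "1 \<le> 2 * (pi / 4) * tan (pi / 4)"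
    using pi_gt3 by (simp add: tan_45)
  ultimately obtain x where "0 \<le> x" "x \<le> pi / 4" "2 * x * tan x = 1"
    using IVT'[of "\<lambda>x. 2 * x * tan x" 0 1 "pi / 4"] by auto
  then show ?thesis using assms[of x] by linarith
qed

lemma wirtinger_jacobian_harmonic:
  assumes hol: "h holomorphic_on S" "g holomorphic_on S" and S: "open S" "z \<in> S"
    and f: "\<And>w. w \<in> S \<Longrightarrow> f w = h w + cnj (g w)"
  shows "wirtinger_jacobian f z = (cmod (deriv h z))\<^sup>2 - (cmod (deriv g z))\<^sup>2"
proof -
  have dir: "vector_derivative (\<lambda>t. f (z + d * of_real t)) (at 0) = d * deriv h z + cnj (d * deriv g z)"
    for d
  proof -
    define p where "p t = z + d * of_real t" for t :: real
    have p: "(p has_vector_derivative d) (at 0)"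
      unfolding p_def by (auto intro!: derivative_eq_intros has_vector_derivative_real_field)
    have chain: "((\<lambda>t. F (p t)) has_vector_derivative d * deriv F z) (at 0)"
      if "F holomorphic_on S" for F
      using field_vector_diff_chain_at[OF p, of F "deriv F z"] holomorphic_derivI[OF that S]
      by (simp add: o_def p_def)
    have "((\<lambda>t. h (p t) + cnj (g (p t))) has_vector_derivative d * deriv h z + cnj (d * deriv g z)) (at 0)"
      by (intro has_vector_derivative_add bounded_linear.has_vector_derivative[OF bounded_linear_cnj]
          chain hol)
    moreover have "open (p -` S)"
      unfolding p_def using S(1) by (intro open_vimage continuous_intros)
    ultimately have "((\<lambda>t. f (p t)) has_vector_derivative d * deriv h z + cnj (d * deriv g z)) (at 0)"
      by (rule has_vector_derivative_transform_within_open) (use S f in \<open>auto simp: p_def\<close>)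
    then show ?thesis unfolding p_def by (rule vector_derivative_at)
  qed
  have px: "partial_x f z = deriv h z + cnj (deriv g z)"
    using dir[of 1] by (simp add: partial_x_def)
  have py: "partial_y f z = \<i> * deriv h z - \<i> * cnj (deriv g z)"
    unfolding partial_y_def dir by simp
  have "wirtinger_z f z = deriv h z" "wirtinger_zbar f z = cnj (deriv g z)"
    unfolding wirtinger_z_def wirtinger_zbar_def px py by (simp_all add: algebra_simps)
  then show ?thesis by (simp add: wirtinger_jacobian_def)
qed

text \<open>By Lewy's theorem \<open>|h'| - |g'|\<close> has no zero, and on a connected set it keeps its sign.\<close>

lemma sense_preserving_if_jacobian_pos_somewhere:
  assumes hol: "h holomorphic_on S" "g holomorphic_on S" and S: "open S" "connected S"
    and f: "\<And>w. w \<in> S \<Longrightarrow> f w = h w + cnj (g w)"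
    and univ: "locally_univalent_on f S"
    and pos: "z\<^sub>0 \<in> S" "wirtinger_jacobian f z\<^sub>0 > 0"
    and z: "z \<in> S"
  shows "cmod (deriv g z) < cmod (deriv h z)"
proof (rule ccontr)
  define J where "J w = cmod (deriv h w) - cmod (deriv g w)" for w
  assume "\<not> ?thesis"
  then have "J z \<le> 0" by (simp add: J_def)
  moreover have "0 \<le> J z\<^sub>0"
    using pos(2) wirtinger_jacobian_harmonic[OF hol S(1) pos(1) f] power2_less_imp_less[of "cmod (deriv g z\<^sub>0)"]
    by (simp add: J_def less_imp_le)
  moreover have "connected (J ` S)"
    unfolding J_def using S hol
    by (intro connected_continuous_image continuous_intros holomorphic_on_imp_continuous_on holomorphic_deriv)
  ultimately have "0 \<in> J ` S"
    using z pos(1) by (meson connectedD_interval imageI)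
  then obtain a where a: "a \<in> S" "cmod (deriv h a) = cmod (deriv g a)" by (auto simp: J_def)
  obtain U where U: "open U" "a \<in> U" "inj_on f (U \<inter> S)"
    using univ a(1) by (auto simp: locally_univalent_on_def)
  have "inj_on (\<lambda>w. h w + cnj (g w)) (U \<inter> S)"
    using U(3) f by (simp add: inj_on_def)
  from lewy_jacobian_nonzero[OF _ _ _ _ this, of a] show False
    using U S a hol by (meson Int_iff holomorphic_on_subset inf_le2 open_Int)
qed

text \<open>The function \<open>L = log h'\<close> has derivative \<open>h''/h'\<close>, so it stays within distance \<open>1 < \<pi>/2\<close>
  of \<open>L 0\<close>, and \<open>h' z / h' 0\<close> has positive real part.\<close>

lemma inj_on_ball_if_pre_schwarzian_le_one:
  assumes holh: "h holomorphic_on ball 0 1" and holL: "L holomorphic_on ball 0 1"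
    and hL: "\<And>z. z \<in> ball 0 1 \<Longrightarrow> deriv h z = exp (L z)"
    and L1: "\<And>z. z \<in> ball 0 1 \<Longrightarrow> cmod (deriv L z) \<le> 1"
  shows "inj_on h (ball 0 1)"
proof (rule noshiro_warschawski[OF holh open_ball convex_ball])
  fix z :: complex assume z: "z \<in> ball 0 1"
  have "cmod (L z - L 0) \<le> 1 * cmod (z - 0)"
    by (rule field_differentiable_bound[OF convex_ball[of 0 1]])
      (use z L1 holomorphic_derivI[OF holL open_ball] in auto)
  then have "\<bar>Im (L z - L 0)\<bar> < 1" using z abs_Im_le_cmod[of "L z - L 0"] by simp
  then have "0 < cos (Im (L z - L 0))" using pi_gt3 by (intro cos_gt_zero_pi) auto
  moreover have "exp (- L 0) * deriv h z = exp (L z - L 0)"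
    using hL[OF z] by (simp add: exp_diff exp_minus divide_inverse)
  ultimately show "0 < Re (exp (- L 0) * deriv h z)" by (simp add: Re_exp)
qed

theorem proposition1:
  fixes f h g :: "complex \<Rightarrow> complex" and c :: real
  assumes "h holomorphic_on ball 0 1"
    and "g holomorphic_on ball 0 1"
    and "\<And>z. z \<in> ball 0 1 \<Longrightarrow> f z = h z + cnj (g z)"
    and "locally_univalent_on f (ball 0 1)"
    and "\<exists>z\<in>ball 0 1. wirtinger_jacobian f z > 0"
    and "deriv (deriv h) 0 = 0"
    and "c \<ge> 0" and "2 * c * tan c = 1"
    and "\<And>x. 0 \<le> x \<Longrightarrow> x < c \<Longrightarrow> 2 * x * tan x \<noteq> 1"
    and "\<And>z. z \<in> ball 0 1 \<Longrightarrow> cmod (schwarzian h z) \<le> 2 * c\<^sup>2"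
  shows "inj_on f (ball 0 1)"
proof -
  let ?D = "ball (0::complex) 1"
  have dil: "cmod (deriv g z) < cmod (deriv h z)" if "z \<in> ?D" for z
    using assms(5) sense_preserving_if_jacobian_pos_somewhere[OF assms(1,2) open_ball connected_ball assms(3,4) _ _ that]
    by blast
  obtain L where holL: "L holomorphic_on ?D" and hL: "\<And>z. z \<in> ?D \<Longrightarrow> deriv h z = exp (L z)"
  proof (rule contractible_imp_holomorphic_log)
    show "deriv h holomorphic_on ?D" using assms(1) by (intro holomorphic_deriv) auto
    show "contractible ?D" by (intro convex_imp_contractible convex_ball)
    show "deriv h z \<noteq> 0" if "z \<in> ?D" for z using dil[OF that] by auto
  qed (rule that)
  have dL: "(L has_field_derivative deriv L z) (at z)" if "z \<in> ?D" for z
    using holomorphic_derivI[OF holL open_ball that] .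
  have h'': "deriv (deriv h) z = deriv L z * deriv h z" if z: "z \<in> ?D" for z
  proof -
    have "((\<lambda>w. exp (L w)) has_field_derivative exp (L z) * deriv L z) (at z)"
      by (rule DERIV_chain2[OF DERIV_exp dL[OF z]])
    then have "(deriv h has_field_derivative exp (L z) * deriv L z) (at z)"
      by (rule has_field_derivative_transform_within_open[OF _ open_ball z]) (simp add: hL)
    then show ?thesis using hL[OF z] by (simp add: DERIV_imp_deriv)
  qed
  have p: "deriv (deriv h) z / deriv h z = deriv L z" if "z \<in> ?D" for z
    using h''[OF that] hL[OF that] by simp
  have holp: "deriv L holomorphic_on ?D" using holL by (intro holomorphic_deriv) auto
  have schwarzian: "schwarzian h z = deriv (deriv L) z - (deriv L z)\<^sup>2 / 2" if z: "z \<in> ?D" for z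
  proof -
    have "((\<lambda>w. deriv (deriv h) w / deriv h w) has_field_derivative deriv (deriv L) z) (at z)"
      by (rule has_field_derivative_transform_within_open[OF holomorphic_derivI[OF holp open_ball z] open_ball z])
        (simp add: p)
    then show ?thesis using p[OF z] by (simp add: schwarzian_def DERIV_imp_deriv)
  qed
  have c: "0 < c" "c \<le> pi / 4"
  proof -
    show "0 < c" using assms(7,8) by (cases "c = 0") auto
    show "c \<le> pi / 4" by (rule first_root_le_pi_quarter) (rule assms(9))
  qed
  have riccati: "cmod (deriv (deriv L) z) \<le> 2 * c\<^sup>2 + (cmod (deriv L z))\<^sup>2 / 2" if z: "z \<in> ?D" for z
  proof -
    have "deriv (deriv L) z = schwarzian h z + (deriv L z)\<^sup>2 / 2" using schwarzian[OF z] by simp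
    then have "cmod (deriv (deriv L) z) \<le> cmod (schwarzian h z) + cmod ((deriv L z)\<^sup>2 / 2)"
      by (simp only: norm_triangle_ineq)
    then show ?thesis using assms(10)[OF z] by (simp add: norm_divide norm_power)
  qed
  have L1: "cmod (deriv L z) < 1" if z: "z \<in> ?D" for z
  proof -
    have "deriv L 0 = 0" using p[of 0] assms(6) by simp
    then have "cmod (deriv L z) \<le> 2 * c * tan (c * cmod z)"
      by (rule riccati_tan_bound[OF holp _ c(1) _ riccati z]) (use c pi_gt_zero in auto)
    also have "\<dots> < 2 * c * tan c"
    proof -
      have "0 \<le> c * cmod z" "c * cmod z < c" using c z by simp_all
      then have "tan (c * cmod z) < tan c"
        using c pi_gt_zero by (intro tan_monotone) linarith+
      then show ?thesis using c by simp
    qed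
    finally show ?thesis using assms(8) by simp
  qed
  have convex: "0 < Re (1 + z * deriv L z)" if z: "z \<in> ?D" for z
  proof -
    have "cmod (z * deriv L z) \<le> cmod z * 1"
      unfolding norm_mult using L1[OF z] by (intro mult_left_mono) auto
    then show ?thesis using z abs_Re_le_cmod[of "z * deriv L z"] by simp
  qed
  have "inj_on (\<lambda>z. h z + cnj (g z)) ?D"
  proof (rule harmonic_shear_inj[OF assms(1,2) _ _ dil])
    show "inj_on h ?D"
      by (rule inj_on_ball_if_pre_schwarzian_le_one[OF assms(1) holL hL])
        (use L1 less_imp_le in blast)+
    show "0 < Re ((h z - h w) / (z * deriv h z))"
      if "z \<in> ?D" "cmod w = cmod z" "w \<noteq> z" for z w
      by (rule circle_chord_half_plane[OF assms(1) holL hL convex that])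
  qed
  then show ?thesis using assms(3) by (simp add: inj_on_def)
qed

end
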